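(* Let $f:2^V\to\mathbb{R}_{\ge 0}$ be a monotone performance metric and $k$ a positive integer. Define $r_1=\mathrm{rank}(\mathcal{M}_1)$, $r_2=\mathrm{rank}(\mathcal{M}_2)$, $\hat{\mathcal{M}}_1=\mathcal{M}_1\vee U_{k-r_1}$ and $\hat{\mathcal{M}}_2=\mathcal{M}_2\vee U_{k-r_2}$, and let $\hat{\mathcal{B}}_1,\hat{\mathcal{B}}_2$ denote the sets of bases of $\hat{\mathcal{M}}_1,\hat{\mathcal{M}}_2$. Let $S^{\ast}$ denote the optimal solution to $$\text{maximize}_{S\subseteq V}\ f(S)\quad\text{s.t.}\quad S\in\hat{\mathcal{B}}_1\cap\hat{\mathcal{B}}_2 .$$ Then $S^{\ast}$ is the optimal solution to $$\text{maximize}_{S\subseteq V}\ f(S)\quad\text{s.t.}\quad |S|\le k,\ (V\setminus S)\in\mathcal{M}_1^{\ast},\ (V\setminus S)\in\mathcal{M}_2^{\ast}.$$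
   Context: $U_j$ is the uniform matroid on $V$ whose independent sets are the sets of size at most $j$; $\vee$ is matroid union; $X\in\mathcal{M}$ means $X$ is independent in $\mathcal{M}$; $\mathcal{M}^{\ast}$ is the dual matroid. **System.** $V=\{1,\dots,n\}$ indexes the states of $F\dot{\mathbf{x}}(t)=A\mathbf{x}(t)$, where $F=Q_F+T_F$, $A=Q_A+T_A$ are $n\times n$; $Q_F,Q_A$ are known fixed real matrices and $T_F,T_A$ are structure matrices: their nonzero entries are independent free parameters that can take any real value. The system is assumed solvable: for every initial state there is a unique trajectory. $T_B(S)$ is the $n\times n$ diagonal matrix with a free parameter in the $i$-th diagonal entry for $i\in S$ and zeros elsewhere. **Matroid $\mathcal{M}_1$.** $\mathcal{M}([I|Q_A|0])$ and $\mathcal{M}([I|T_A|T_B(S)])$ denote the linear matroids on the common set of $3n$ column indices (free parameters algebraically independent). Put $\rho_1(S)=\mathrm{rank}(\mathcal{M}([I|Q_A|0])\vee\mathcal{M}([I|T_A|T_B(S)]))-\mathrm{rank}(\mathcal{M}([I|Q_A])\vee\mathcal{M}([I|T_A]))$. This is the rank function of a matroid $\mathcal{M}_1$ on $V$. **Auxiliary graph $G'$.** Let $\Omega=\begin{pmatrix}Q_A-Q_F\\ I\end{pmatrix}$, with rows indexed $w_1,\dots,w_n,x_1,\dots,x_n$. Say $(i,j)\in T$ if the $(i,j)$ entry of $T_A$ or $T_F$ is nonzero. Let $H$ be the bipartite graph with sides $\{w_i^T\}$ and $\{w_i^Q\}\cup\{x_i^Q\}$ and edges $(w_i^T,w_i^Q)$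 for all $i$, and $(w_i^T,x_j^Q)$ for $(i,j)\in T$. By solvability there is a matching $m$ of $H$ matching all $w_i^T$ such that the rows in $J=\{w_i:m(w_i^T)=w_i^Q\}\cup\{x_j: m(w_i^T)=x_j^Q\text{ for some }i\}$ are linearly independent in $\Omega$; fix such an $m$. Let $\Omega_J$ be the submatrix of rows $J$ and $\tilde\Omega=\Omega\Omega_J^{-1}$, with columns indexed by $J$. $G'=(V',E')$ is the directed graph with vertices $w_i^T,w_i^Q,x_i^T,x_i^Q$ ($i=1,\dots,n$) and edges: $w_i^T\to x_j^Q$ if $(i,j)\in T$, $m(w_i^T)\ne x_j^Q$; $x_j^Q\to w_i^T$ if $(i,j)\in T$, $m(w_i^T)=x_j^Q$; $w_i^T\to w_i^Q$ if $m(w_i^T)\neq w_i^Q$; $w_i^Q\to w_i^T$ if $m(w_i^T)=w_i^Q$; $a^Q\to b^Q$ for $a\notin J$, $b\in J$, $\tilde\Omega_{ab}\ne0$. **Matroid $\mathcal{M}_2$.** Let $\overline{V}'$ be the set of strongly connected components of $G'$ with no outgoing edge to another component. Identifying $i\in V$ with $w_i^T$, set $\rho_2(S)=|\{C\in\overline{V}': C\cap\{w_i^T:i\in S\}\neq\emptyset\}|$. This is the rank function of a matroid $\mathcal{M}_2$ on $V$. *)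

theory Defs
  imports
    "HOL-Analysis.Analysis"
    "HOL-Library.Poly_Mapping"
    "HOL-Library.Countable"
    "HOL-Computational_Algebra.Fraction_Field"
    "Graph_Theory.Digraph_Component"
begin

section \<open>Matroids\<close>

text \<open>
  A matroid is given by its family of independent sets; the ground set is always the whole
  (finite) type. None of the operations below presupposes the matroid axioms.
\<close>

definition matroid_bases :: "'a set set \<Rightarrow> 'a set set" where
  "matroid_bases M = {B \<in> M. \<forall>X\<in>M. B \<subseteq> X \<longrightarrow> X = B}"

definition matroid_rank :: "'a set set \<Rightarrow> nat" where
  "matroid_rank M = Max (card ` M)"

definition matroid_union :: "'a set set \<Rightarrow> 'a set set \<Rightarrow> 'a set set" where
  "matroid_union M N = {X \<union> Y | X Y. X \<in> M \<and> Y \<in> N}"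

definition matroid_dual :: "'a set set \<Rightarrow> 'a set set" where
  "matroid_dual M = {X. \<exists>B\<in>matroid_bases M. X \<inter> B = {}}"

text \<open>
  The index is an integer because it will be \<open>k - r\<close>; for a negative index no set qualifies,
  not even the empty one.
\<close>

definition uniform_matroid :: "int \<Rightarrow> 'a::finite set set" where
  "uniform_matroid j = {X. int (card X) \<le> j}"

definition matroid_of_rank_function :: "('a::finite set \<Rightarrow> int) \<Rightarrow> 'a set set" where
  "matroid_of_rank_function \<rho> = {X. \<rho> X = int (card X)}"

text \<open>
  Linear matroid on the column indices. Injectivity is needed because equal columns at different
  indices are dependent.
\<close>

definition linear_matroid :: "'k::field^'c^'r \<Rightarrow> 'c set set" where
  "linear_matroid M =
     {X. inj_on (\<lambda>c. column c M) X \<and> vec.independent ((\<lambda>c. column c M) ` X)}"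

definition augment :: "nat \<Rightarrow> 'a::finite set set \<Rightarrow> 'a set set" where
  "augment k M = matroid_union M (uniform_matroid (int k - int (matroid_rank M)))"


section \<open>Structure matrices\<close>

text \<open>
  The free parameters are the variables of a polynomial ring over the reals, and the generic
  structure matrices live in its fraction field; so the parameters are algebraically independent.
  Variables are numbered through \<^const>\<open>to_nat\<close>, since \<^type>\<open>poly_mapping\<close> is an integral domain
  only for linearly ordered exponents.
\<close>

datatype 'n parameter = Par_F 'n 'n | Par_A 'n 'n | Par_B 'n

instance parameter :: (countable) countable
  by countable_datatype

type_synonym parameter_field = "((nat \<Rightarrow>\<^sub>0 nat) \<Rightarrow>\<^sub>0 real) fract"

definition free_parameter :: "'n::countable parameter \<Rightarrow> parameter_field" where
  "free_parameter p =
     Fract (Poly_Mapping.single (Poly_Mapping.single (to_nat p) 1) 1) 1"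

text \<open>\<open>E\<close> is the set of positions of the nonzero entries.\<close>

definition generic_F :: "('n \<times> 'n) set \<Rightarrow> parameter_field^'n::finite^'n" where
  "generic_F E = (\<chi> i j. if (i, j) \<in> E then free_parameter (Par_F i j) else 0)"

definition generic_A :: "('n \<times> 'n) set \<Rightarrow> parameter_field^'n::finite^'n" where
  "generic_A E = (\<chi> i j. if (i, j) \<in> E then free_parameter (Par_A i j) else 0)"

definition generic_B :: "'n set \<Rightarrow> parameter_field^'n::finite^'n" where
  "generic_B S = (\<chi> i j. if i = j \<and> i \<in> S then free_parameter (Par_B i) else 0)"


section \<open>Solvability\<close>

definition realization :: "('n \<times> 'n) set \<Rightarrow> real^'n::finite^'n \<Rightarrow> bool" where
  "realization E T \<longleftrightarrow> (\<forall>i j. (i, j) \<notin> E \<longrightarrow> T $ i $ j = 0)"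

definition trajectory :: "real^'n::finite^'n \<Rightarrow> real^'n^'n \<Rightarrow> real^'n \<Rightarrow> (real \<Rightarrow> real^'n) \<Rightarrow> bool" where
  "trajectory F A x0 x \<longleftrightarrow>
     x 0 = x0 \<and>
     (\<exists>x'. \<forall>t\<ge>0. (x has_vector_derivative x' t) (at t within {0..}) \<and> F *v x' t = A *v x t)"

definition admissible_state :: "real^'n::finite^'n \<Rightarrow> real^'n^'n \<Rightarrow> real^'n \<Rightarrow> bool" where
  "admissible_state F A x0 \<longleftrightarrow> (\<exists>x. trajectory F A x0 x)"

text \<open>
  When \<open>F\<close> is singular, a state violating the algebraic constraints is not the initial state of
  any differentiable trajectory, so initial states range over the admissible ones, as is usual for
  descriptor systems (asking for a trajectory from every vector would force \<open>F\<close> to be invertible).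
  For square matrices this amounts to regularity of the pencil \<open>s F - A\<close>.
\<close>

definition solvable :: "real^'n::finite^'n \<Rightarrow> real^'n^'n \<Rightarrow> bool" where
  "solvable F A \<longleftrightarrow>
     (\<forall>x0. admissible_state F A x0 \<longrightarrow>
        (\<exists>x. trajectory F A x0 x \<and>
             (\<forall>y. trajectory F A x0 y \<longrightarrow> (\<forall>t\<ge>0. y t = x t))))"

text \<open>
  Solvability is a generic property: it holds for some values of the free parameters iff it holds
  for all values off the zero set of a nonzero polynomial.
\<close>

definition structurally_solvable ::
  "real^'n::finite^'n \<Rightarrow> ('n \<times> 'n) set \<Rightarrow> real^'n^'n \<Rightarrow> ('n \<times> 'n) set \<Rightarrow> bool" where
  "structurally_solvable Q_F E_F Q_A E_A \<longleftrightarrow>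
     (\<exists>T_F T_A. realization E_F T_F \<and> realization E_A T_A \<and> solvable (Q_F + T_F) (Q_A + T_A))"


section \<open>The matroid $M_1$\<close>

definition hcat :: "'k^'b^'r \<Rightarrow> 'k^'c^'r \<Rightarrow> 'k^('b + 'c)^'r" where
  "hcat A B = (\<chi> i c. case c of Inl b \<Rightarrow> A $ i $ b | Inr c' \<Rightarrow> B $ i $ c')"

definition rho1 :: "real^'n::finite^'n \<Rightarrow> ('n \<times> 'n) set \<Rightarrow> 'n set \<Rightarrow> int" where
  "rho1 Q_A E_A S =
     int (matroid_rank (matroid_union
       (linear_matroid (hcat (mat 1) (hcat Q_A 0)))
       (linear_matroid (hcat (mat 1) (hcat (generic_A E_A) (generic_B S)))))) -
     int (matroid_rank (matroid_union
       (linear_matroid (hcat (mat 1) Q_A))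
       (linear_matroid (hcat (mat 1) (generic_A E_A)))))"

definition matroid1 :: "real^'n::finite^'n \<Rightarrow> ('n \<times> 'n) set \<Rightarrow> 'n set set" where
  "matroid1 Q_A E_A = matroid_of_rank_function (rho1 Q_A E_A)"


section \<open>The auxiliary graph and the matroid $M_2$\<close>

text \<open>The labels $w_i$ and $x_i$ are \<open>Inl i\<close> and \<open>Inr i\<close>; every label occurs with superscript T and Q.\<close>

datatype 'n vertex = T_vertex "'n + 'n" | Q_vertex "'n + 'n"

abbreviation wT :: "'n \<Rightarrow> 'n vertex" where "wT i \<equiv> T_vertex (Inl i)"
abbreviation wQ :: "'n \<Rightarrow> 'n vertex" where "wQ i \<equiv> Q_vertex (Inl i)"
abbreviation xQ :: "'n \<Rightarrow> 'n vertex" where "xQ i \<equiv> Q_vertex (Inr i)"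

definition Omega :: "real^'n::finite^'n \<Rightarrow> real^'n^'n \<Rightarrow> real^'n^('n + 'n)" where
  "Omega Q_F Q_A = (\<chi> r. case r of Inl i \<Rightarrow> (Q_A - Q_F) $ i | Inr i \<Rightarrow> mat 1 $ i)"

definition T_positions :: "('n::finite \<times> 'n) set \<Rightarrow> ('n \<times> 'n) set \<Rightarrow> ('n \<times> 'n) set" where
  "T_positions E_F E_A = {(i, j). generic_A E_A $ i $ j \<noteq> 0 \<or> generic_F E_F $ i $ j \<noteq> 0}"

definition H_edges :: "('n::finite \<times> 'n) set \<Rightarrow> ('n \<times> 'n) set \<Rightarrow> ('n vertex \<times> 'n vertex) set" where
  "H_edges E_F E_A =
     {(wT i, wQ i) | i. True} \<union> {(wT i, xQ j) | i j. (i, j) \<in> T_positions E_F E_A}"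

text \<open>
  A matching covering all $w_i^T$ is a function \<open>m\<close>, with \<open>Q_vertex (m i)\<close> the partner of \<open>wT i\<close>.
\<close>

definition matched_rows :: "('n \<Rightarrow> 'n + 'n) \<Rightarrow> ('n + 'n) set" where
  "matched_rows m = {Inl i | i. m i = Inl i} \<union> {Inr j | j. \<exists>i. m i = Inr j}"

definition independent_matching ::
  "real^'n::finite^'n \<Rightarrow> ('n \<times> 'n) set \<Rightarrow> real^'n^'n \<Rightarrow> ('n \<times> 'n) set \<Rightarrow> ('n \<Rightarrow> 'n + 'n) \<Rightarrow> bool" where
  "independent_matching Q_F E_F Q_A E_A m \<longleftrightarrow>
     (\<forall>i. (wT i, Q_vertex (m i)) \<in> H_edges E_F E_A) \<and> inj m \<and>
     inj_on (\<lambda>r. Omega Q_F Q_A $ r) (matched_rows m) \<and>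
     independent ((\<lambda>r. Omega Q_F Q_A $ r) ` matched_rows m)"

text \<open>
  The rows of \<open>Omega_J\<close>, hence the columns of its inverse and of \<open>Omega_tilde\<close>, are enumerated along
  the bijection \<open>m\<close> onto \<open>J = matched_rows m\<close>: the column of \<open>Omega_tilde\<close> belonging to \<open>b = m i\<close>
  in \<open>J\<close> is column \<open>i\<close>.
\<close>

definition Omega_J :: "real^'n::finite^'n \<Rightarrow> real^'n^'n \<Rightarrow> ('n \<Rightarrow> 'n + 'n) \<Rightarrow> real^'n^'n" where
  "Omega_J Q_F Q_A m = (\<chi> i. Omega Q_F Q_A $ m i)"

definition Omega_tilde ::
  "real^'n::finite^'n \<Rightarrow> real^'n^'n \<Rightarrow> ('n \<Rightarrow> 'n + 'n) \<Rightarrow> real^'n^('n + 'n)" where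
  "Omega_tilde Q_F Q_A m = Omega Q_F Q_A ** matrix_inv (Omega_J Q_F Q_A m)"

definition auxiliary_graph ::
  "real^'n::finite^'n \<Rightarrow> ('n \<times> 'n) set \<Rightarrow> real^'n^'n \<Rightarrow> ('n \<times> 'n) set \<Rightarrow> ('n \<Rightarrow> 'n + 'n) \<Rightarrow>
     'n vertex pair_pre_digraph" where
  "auxiliary_graph Q_F E_F Q_A E_A m =
     \<lparr> pverts = UNIV,
       parcs =
         {(wT i, xQ j) | i j. (i, j) \<in> T_positions E_F E_A \<and> m i \<noteq> Inr j} \<union>
         {(xQ j, wT i) | i j. (i, j) \<in> T_positions E_F E_A \<and> m i = Inr j} \<union>
         {(wT i, wQ i) | i. m i \<noteq> Inl i} \<union>
         {(wQ i, wT i) | i. m i = Inl i} \<union>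
         {(Q_vertex a, Q_vertex (m i)) | a i.
            a \<notin> matched_rows m \<and> m i \<in> matched_rows m \<and> Omega_tilde Q_F Q_A m $ a $ i \<noteq> 0} \<rparr>"

definition sink_components :: "'a pair_pre_digraph \<Rightarrow> 'a set set" where
  "sink_components G =
     {C \<in> pre_digraph.sccs_verts (with_proj G). \<forall>u v. (u, v) \<in> parcs G \<and> u \<in> C \<longrightarrow> v \<in> C}"

definition rho2 ::
  "real^'n::finite^'n \<Rightarrow> ('n \<times> 'n) set \<Rightarrow> real^'n^'n \<Rightarrow> ('n \<times> 'n) set \<Rightarrow> ('n \<Rightarrow> 'n + 'n) \<Rightarrow>
     'n set \<Rightarrow> int" where
  "rho2 Q_F E_F Q_A E_A m S =
     int (card {C \<in> sink_components (auxiliary_graph Q_F E_F Q_A E_A m). C \<inter> wT ` S \<noteq> {}})"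

definition matroid2 ::
  "real^'n::finite^'n \<Rightarrow> ('n \<times> 'n) set \<Rightarrow> real^'n^'n \<Rightarrow> ('n \<times> 'n) set \<Rightarrow> ('n \<Rightarrow> 'n + 'n) \<Rightarrow>
     'n set set" where
  "matroid2 Q_F E_F Q_A E_A m = matroid_of_rank_function (rho2 Q_F E_F Q_A E_A m)"

end

theory Submission
  imports Defs
begin

text \<open>
  The complement of \<open>S\<close> is independent in the dual of \<open>M\<close> iff \<open>S\<close> contains a basis of \<open>M\<close>. Adding the
  uniform matroid of rank \<open>k - r\<close> to a matroid \<open>M\<close> of rank \<open>r \<le> k\<close> yields a matroid whose bases are the
  sets of size \<open>min k |V|\<close> that contain a basis of \<open>M\<close>. So every common basis of the two augmented
  matroids is feasible for the second problem. Conversely, a feasible \<open>S\<close> for the second problem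
  extends to a set of size \<open>min k |V|\<close>, which is a common basis and, by monotonicity of \<open>f\<close>, has at
  least the value of \<open>S\<close>. Thus a maximizer over the common bases is a maximizer over the larger
  feasible set (\<open>augment_basis_contains_basis\<close>, \<open>augment_basisI\<close>).

  What has to be known about \<open>M\<^sub>1\<close> and \<open>M\<^sub>2\<close> is only that all their bases, in the sense of
  inclusion-maximal independent sets, have the same cardinality; otherwise a small basis \<open>B\<close> could
  leave more elements to fill up than the \<open>k - r\<close> that the uniform matroid supplies. This
  follows from properties of the rank functions (\<open>basis_card_eq_rank_of_rank_function\<close>). For \<open>M\<^sub>2\<close>
  they are immediate because strongly connected components are disjoint. For \<open>M\<^sub>1\<close>, the rank
  function is up to a constant a restriction of the rank function of the union of two linear
  matroids on the \<open>3n\<close> columns (\<open>union_input_restriction\<close>), so it suffices that a union of matroids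
  has the exchange property (\<open>exchange_property_union\<close>). That is proved by choosing partitions of
  the two sets into independent parts that disagree as little as possible.
\<close>


section \<open>Bases of equal cardinality\<close>

lemma matroid_card_le_rank:
  fixes M :: "'a::finite set set"
  assumes "X \<in> M"
  shows "card X \<le> matroid_rank M"
  using assms unfolding matroid_rank_def by simp

lemma matroid_rank_attained:
  fixes M :: "'a::finite set set"
  assumes "X \<in> M"
  obtains Y where "Y \<in> M" "card Y = matroid_rank M"
proof -
  have "matroid_rank M \<in> card ` M"
    unfolding matroid_rank_def using assms by (intro Max_in) auto
  with that show thesis by auto
qed

lemma basis_extension:
  fixes M :: "'a::finite set set"
  assumes "X \<in> M"
  obtains B where "B \<in> matroid_bases M" "X \<subseteq> B"
proof -
  obtain B where "B \<in> M" "X \<subseteq> B" "\<forall>Y\<in>M. B \<subseteq> Y \<longrightarrow> B = Y"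
    using finite_has_maximal2[OF _ assms] by auto
  with that show thesis unfolding matroid_bases_def by blast
qed

text \<open>
  Equal cardinality of the bases needs less than the axioms of a rank function. Submodularity is
  used only in the form that a set to which no single element adds rank has full rank, and the
  value at the empty set is irrelevant: a maximal \<open>B\<close> with \<open>\<rho> B = |B|\<close> has \<open>|B| = \<rho> UNIV\<close>, and
  monotonicity bounds every other independent set by the same number.
\<close>

lemma basis_card_eq_rank_of_rank_function:
  fixes \<rho> :: "'a::finite set \<Rightarrow> int"
  assumes mono: "\<And>S T. S \<subseteq> T \<Longrightarrow> \<rho> S \<le> \<rho> T"
    and unit: "\<And>S x. \<rho> (insert x S) \<le> \<rho> S + 1"
    and global: "\<And>S. (\<And>x. \<rho> (insert x S) = \<rho> S) \<Longrightarrow> \<rho> UNIV = \<rho> S"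
    and B: "B \<in> matroid_bases (matroid_of_rank_function \<rho>)"
  shows "card B = matroid_rank (matroid_of_rank_function \<rho>)"
proof -
  let ?M = "matroid_of_rank_function \<rho>"
  have BM: "B \<in> ?M" and max: "\<And>X. X \<in> ?M \<Longrightarrow> B \<subseteq> X \<Longrightarrow> X = B"
    using B by (auto simp: matroid_bases_def)
  have rB: "\<rho> B = int (card B)"
    using BM by (simp add: matroid_of_rank_function_def)
  have "\<rho> (insert x B) = \<rho> B" for x
  proof (rule ccontr)
    assume ne: "\<rho> (insert x B) \<noteq> \<rho> B"
    then have "x \<notin> B" by (auto simp: insert_absorb)
    moreover have "\<rho> (insert x B) = \<rho> B + 1"
      using ne mono[of B "insert x B"] unit[of x B] by fastforce
    ultimately have "insert x B \<in> ?M"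
      using rB by (simp add: matroid_of_rank_function_def)
    with max[of "insert x B"] \<open>x \<notin> B\<close> show False by auto
  qed
  then have top: "\<rho> UNIV = \<rho> B" by (rule global)
  obtain Y where Y: "Y \<in> ?M" "card Y = matroid_rank ?M"
    using matroid_rank_attained[OF BM] .
  then have "int (card Y) \<le> \<rho> UNIV"
    using mono[of Y UNIV] by (simp add: matroid_of_rank_function_def)
  with Y top rB matroid_card_le_rank[OF BM] show ?thesis by simp
qed


section \<open>Matroid union\<close>

text \<open>
  The two matroid axioms other than nonemptiness, as separate properties of a family of sets. In
  the exchange axiom \<open>card\<close> is meaningful only for finite members; it is applied over finite types.
\<close>

definition exchange_property :: "'a set set \<Rightarrow> bool" where
  "exchange_property M \<longleftrightarrow>
     (\<forall>X\<in>M. \<forall>Y\<in>M. card X < card Y \<longrightarrow> (\<exists>y\<in>Y - X. insert y X \<in> M))"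

definition downward_closed :: "'a set set \<Rightarrow> bool" where
  "downward_closed M \<longleftrightarrow> (\<forall>X\<in>M. \<forall>Y\<subseteq>X. Y \<in> M)"

lemma downward_closed_union:
  assumes "downward_closed M" "downward_closed N"
  shows "downward_closed (matroid_union M N)"
  unfolding downward_closed_def
proof (intro ballI allI impI)
  fix Z W assume "Z \<in> matroid_union M N" "W \<subseteq> Z"
  then obtain X Y where "X \<in> M" "Y \<in> N" "Z = X \<union> Y"
    by (auto simp: matroid_union_def)
  then have "X \<inter> W \<in> M" "Y \<inter> W \<in> N" "W = (X \<inter> W) \<union> (Y \<inter> W)"
    using assms \<open>W \<subseteq> Z\<close> unfolding downward_closed_def by blast+
  then show "W \<in> matroid_union M N"
    unfolding matroid_union_def by blast
qed

lemma empty_in_matroid_union: "{} \<in> M \<Longrightarrow> {} \<in> N \<Longrightarrow> {} \<in> matroid_union M N"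
  unfolding matroid_union_def by auto

lemma matroid_union_commute: "matroid_union M N = matroid_union N M"
  unfolding matroid_union_def by blast

lemma matroid_union_disjointE:
  assumes "Z \<in> matroid_union M N" "downward_closed N"
  obtains X Y where "X \<in> M" "Y \<in> N" "X \<inter> Y = {}" "Z = X \<union> Y"
proof -
  from assms(1) obtain X Y where "X \<in> M" "Y \<in> N" "Z = X \<union> Y"
    by (auto simp: matroid_union_def)
  moreover from this have "Y - X \<in> N"
    using assms(2) unfolding downward_closed_def by blast
  ultimately show thesis by (intro that[of X "Y - X"]) auto
qed

text \<open>
  The step of the exchange argument for a union: if the first part \<open>I1\<close> of \<open>I1 \<union> I2\<close> is smaller than
  the first part \<open>J1\<close> of \<open>J1 \<union> J2\<close>, then an element \<open>t\<close> of \<open>J1\<close> can be added to \<open>I1\<close>. Either \<open>t\<close> is new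
  to \<open>I1 \<union> I2\<close>, or it moves from \<open>I2\<close> to \<open>I1\<close>, and the two partitions disagree less.
\<close>

lemma union_exchange_or_swap:
  fixes M N :: "'a::finite set set"
  assumes "exchange_property M" "downward_closed N"
    and "I1 \<in> M" "I2 \<in> N" "J1 \<in> M" "I1 \<inter> I2 = {}" "J1 \<inter> J2 = {}" "card I1 < card J1"
  obtains (exchange) t where "t \<in> J1 - (I1 \<union> I2)" "insert t (I1 \<union> I2) \<in> matroid_union M N"
  | (swap) I1' I2' where "I1' \<in> M" "I2' \<in> N" "I1' \<inter> I2' = {}" "I1' \<union> I2' = I1 \<union> I2"
      "card (I1' \<inter> J2) + card (I2' \<inter> J1) < card (I1 \<inter> J2) + card (I2 \<inter> J1)"
proof -
  obtain t where t: "t \<in> J1 - I1" "insert t I1 \<in> M"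
    using assms unfolding exchange_property_def by blast
  show thesis
  proof (cases "t \<in> I2")
    case True
    have "I2 - {t} \<in> N"
      using assms unfolding downward_closed_def by blast
    moreover have "insert t I1 \<inter> J2 = I1 \<inter> J2"
      using t assms by blast
    moreover have "card ((I2 - {t}) \<inter> J1) < card (I2 \<inter> J1)"
      using t True by (intro psubset_card_mono) auto
    moreover have "insert t I1 \<inter> (I2 - {t}) = {}" "insert t I1 \<union> (I2 - {t}) = I1 \<union> I2"
      using True assms by blast+
    ultimately show thesis
      using t by (intro swap[of "insert t I1" "I2 - {t}"]) simp_all
  next
    case False
    then have "insert t (I1 \<union> I2) \<in> matroid_union M N"
      using t assms unfolding matroid_union_def by blast
    with t False show thesis by (intro exchange[of t]) auto
  qed
qed

text \<open>
  The exchange axiom for a matroid union. Of the two parts of the smaller set, at least one is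
  smaller than the corresponding part of the larger set; the induction is on the disagreement of
  the two partitions, which the swap decreases.
\<close>

lemma exchange_property_union:
  fixes M N :: "'a::finite set set"
  assumes exM: "exchange_property M" and exN: "exchange_property N"
    and dcM: "downward_closed M" and dcN: "downward_closed N"
  shows "exchange_property (matroid_union M N)"
proof -
  have main: "\<exists>t\<in>(J1 \<union> J2) - (I1 \<union> I2). insert t (I1 \<union> I2) \<in> matroid_union M N"
    if "I1 \<in> M" "I2 \<in> N" "J1 \<in> M" "J2 \<in> N" "I1 \<inter> I2 = {}" "J1 \<inter> J2 = {}"
      "card (I1 \<union> I2) < card (J1 \<union> J2)"
    for I1 I2 J1 J2
    using that
  proof (induction "card (I1 \<inter> J2) + card (I2 \<inter> J1)" arbitrary: I1 I2 rule: less_induct)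
    case less
    have "card I1 + card I2 < card J1 + card J2"
      using less.prems by (simp add: card_Un_disjoint)
    then consider "card I1 < card J1" | "card I2 < card J2" by linarith
    then show ?case
    proof cases
      case 1
      show ?thesis
      proof (rule union_exchange_or_swap[OF exM dcN less.prems(1-3,5,6) 1])
        fix t assume "t \<in> J1 - (I1 \<union> I2)" "insert t (I1 \<union> I2) \<in> matroid_union M N"
        then show ?thesis by blast
      next
        fix I1' I2'
        assume "I1' \<in> M" "I2' \<in> N" "I1' \<inter> I2' = {}" "I1' \<union> I2' = I1 \<union> I2"
          "card (I1' \<inter> J2) + card (I2' \<inter> J1) < card (I1 \<inter> J2) + card (I2 \<inter> J1)"
        then show ?thesis using less.hyps[of I1' I2'] less.prems by simp
      qed
    next
      case 2
      have disj: "I2 \<inter> I1 = {}" "J2 \<inter> J1 = {}" using less.prems by blast+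
      show ?thesis
      proof (rule union_exchange_or_swap[OF exN dcM less.prems(2,1,4) disj 2])
        fix t assume "t \<in> J2 - (I2 \<union> I1)" "insert t (I2 \<union> I1) \<in> matroid_union N M"
        then show ?thesis by (auto simp: Un_commute matroid_union_commute)
      next
        fix I2' I1'
        assume "I2' \<in> N" "I1' \<in> M" "I2' \<inter> I1' = {}" "I2' \<union> I1' = I2 \<union> I1"
          "card (I2' \<inter> J1) + card (I1' \<inter> J2) < card (I2 \<inter> J1) + card (I1 \<inter> J2)"
        then show ?thesis
          using less.hyps[of I1' I2'] less.prems by (simp add: Un_commute Int_commute)
      qed
    qed
  qed
  show ?thesis
    unfolding exchange_property_def
  proof (intro ballI impI)
    fix I J assume I: "I \<in> matroid_union M N" and J: "J \<in> matroid_union M N"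
      and lt: "card I < card J"
    obtain I1 I2 where "I1 \<in> M" "I2 \<in> N" "I1 \<inter> I2 = {}" "I = I1 \<union> I2"
      using matroid_union_disjointE[OF I dcN] .
    moreover obtain J1 J2 where "J1 \<in> M" "J2 \<in> N" "J1 \<inter> J2 = {}" "J = J1 \<union> J2"
      using matroid_union_disjointE[OF J dcN] .
    ultimately show "\<exists>t\<in>J - I. insert t I \<in> matroid_union M N"
      using main lt by blast
  qed
qed


section \<open>Ranks of restrictions\<close>

text \<open>
  The three hypotheses of the criterion for bases of equal cardinality, for the function sending \<open>S\<close> to the rank of a matroid restricted
  to \<open>S\<close>.
\<close>

lemma rank_restriction_monotone:
  fixes N :: "'e::finite set set"
  assumes "{} \<in> N" "S \<subseteq> T"
  shows "matroid_rank {Z \<in> N. Z \<subseteq> S} \<le> matroid_rank {Z \<in> N. Z \<subseteq> T}"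
  unfolding matroid_rank_def using assms by (intro Max_mono) auto

lemma rank_restriction_insert:
  fixes N :: "'e::finite set set"
  assumes ne: "{} \<in> N" and dc: "downward_closed N"
  shows "matroid_rank {Z \<in> N. Z \<subseteq> insert e S} \<le> matroid_rank {Z \<in> N. Z \<subseteq> S} + 1"
proof -
  obtain Z where Z: "Z \<in> N" "Z \<subseteq> insert e S" "card Z = matroid_rank {Z \<in> N. Z \<subseteq> insert e S}"
    using matroid_rank_attained[of "{}" "{Z \<in> N. Z \<subseteq> insert e S}"] ne by auto
  have "Z - {e} \<in> N" "Z - {e} \<subseteq> S"
    using Z dc by (auto simp: downward_closed_def)
  then have "card (Z - {e}) \<le> matroid_rank {Z \<in> N. Z \<subseteq> S}"
    by (intro matroid_card_le_rank) simp
  moreover have "card Z \<le> card (Z - {e}) + 1"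
    by (cases "e \<in> Z") (simp_all add: card_Diff_singleton_if)
  ultimately show ?thesis using Z(3) by linarith
qed

lemma rank_restriction_eqI:
  fixes N :: "'e::finite set set"
  assumes ne: "{} \<in> N" and ex: "exchange_property N" and "S \<subseteq> T"
    and closed: "\<And>e. e \<in> T \<Longrightarrow>
      matroid_rank {Z \<in> N. Z \<subseteq> insert e S} = matroid_rank {Z \<in> N. Z \<subseteq> S}"
  shows "matroid_rank {Z \<in> N. Z \<subseteq> T} = matroid_rank {Z \<in> N. Z \<subseteq> S}"
proof (rule ccontr)
  assume "\<not> ?thesis"
  then have lt: "matroid_rank {Z \<in> N. Z \<subseteq> S} < matroid_rank {Z \<in> N. Z \<subseteq> T}"
    using rank_restriction_monotone[OF ne \<open>S \<subseteq> T\<close>] by simp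
  obtain X where X: "X \<in> N" "X \<subseteq> S" "card X = matroid_rank {Z \<in> N. Z \<subseteq> S}"
    using matroid_rank_attained[of "{}" "{Z \<in> N. Z \<subseteq> S}"] ne by auto
  obtain Y where Y: "Y \<in> N" "Y \<subseteq> T" "card Y = matroid_rank {Z \<in> N. Z \<subseteq> T}"
    using matroid_rank_attained[of "{}" "{Z \<in> N. Z \<subseteq> T}"] ne by auto
  have "card X < card Y" using lt X Y by simp
  then obtain e where e: "e \<in> Y - X" "insert e X \<in> N"
    using ex X Y unfolding exchange_property_def by blast
  have "card (insert e X) \<le> matroid_rank {Z \<in> N. Z \<subseteq> insert e S}"
    using e X by (intro matroid_card_le_rank) auto
  also have "\<dots> = card X"
    using closed[of e] e X Y by auto
  finally show False using e by simp
qed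


section \<open>Linear matroids\<close>

lemma empty_in_linear_matroid: "{} \<in> linear_matroid A"
  by (simp add: linear_matroid_def vec.independent_empty)

lemma downward_closed_linear_matroid: "downward_closed (linear_matroid A)"
  unfolding downward_closed_def
proof (intro ballI allI impI)
  fix X Y assume X: "X \<in> linear_matroid A" and "Y \<subseteq> X"
  from X have inj: "inj_on (\<lambda>c. column c A) X"
    and ind: "vec.independent ((\<lambda>c. column c A) ` X)"
    unfolding linear_matroid_def by simp_all
  have "inj_on (\<lambda>c. column c A) Y"
    by (rule inj_on_subset[OF inj \<open>Y \<subseteq> X\<close>])
  moreover have "vec.independent ((\<lambda>c. column c A) ` Y)"
    by (rule vec.independent_mono[OF ind image_mono[OF \<open>Y \<subseteq> X\<close>]])
  ultimately show "Y \<in> linear_matroid A" by (simp add: linear_matroid_def)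
qed

lemma exchange_property_linear_matroid:
  fixes A :: "'k::field^'c::finite^'r::finite"
  shows "exchange_property (linear_matroid A)"
  unfolding exchange_property_def
proof (intro ballI impI)
  fix X Y assume X: "X \<in> linear_matroid A" and Y: "Y \<in> linear_matroid A"
    and lt: "card X < card Y"
  let ?c = "\<lambda>i. column i A"
  have "\<not> ?c ` Y \<subseteq> vec.span (?c ` X)"
  proof
    assume "?c ` Y \<subseteq> vec.span (?c ` X)"
    then have "card (?c ` Y) \<le> card (?c ` X)"
      using vec.independent_span_bound[of "?c ` X" "?c ` Y"] Y
      by (simp add: linear_matroid_def)
    moreover have "card (?c ` Y) = card Y" "card (?c ` X) = card X"
      using X Y by (simp_all add: linear_matroid_def card_image)
    ultimately show False using lt by simp
  qed
  then obtain y where y: "y \<in> Y" "?c y \<notin> vec.span (?c ` X)" by blast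
  then have notin: "?c y \<notin> ?c ` X" by (metis vec.span_base)
  then have "y \<notin> X" by blast
  moreover have "insert y X \<in> linear_matroid A"
    using X y notin by (auto simp: linear_matroid_def vec.independent_insert)
  ultimately show "\<exists>y\<in>Y - X. insert y X \<in> linear_matroid A" using y by blast
qed

lemma zero_column_notin_linear_matroid:
  assumes "X \<in> linear_matroid A" "column c A = 0"
  shows "c \<notin> X"
proof
  assume "c \<in> X"
  then have "0 \<in> (\<lambda>c. column c A) ` X" using assms(2) by force
  then have "vec.dependent ((\<lambda>c. column c A) ` X)" by (rule vec.dependent_zero)
  with assms(1) show False by (simp add: linear_matroid_def)
qed

lemma linear_matroid_cong:
  assumes "\<And>c. c \<in> X \<Longrightarrow> column c A = column c A'"
  shows "X \<in> linear_matroid A \<longleftrightarrow> X \<in> linear_matroid A'"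
proof -
  have "inj_on (\<lambda>c. column c A) X = inj_on (\<lambda>c. column c A') X"
    using assms by (intro inj_on_cong) auto
  moreover have "(\<lambda>c. column c A) ` X = (\<lambda>c. column c A') ` X"
    using assms by (intro image_cong) auto
  ultimately show ?thesis by (simp add: linear_matroid_def)
qed


section \<open>The matroid $M_1$\<close>

text \<open>
  The column indices of \<open>[I|T_A|T_B(S)]\<close> other than those of the columns of \<open>T_B(S)\<close> outside \<open>S\<close>,
  which are zero.
\<close>

definition active_columns :: "'n set \<Rightarrow> ('n + ('n + 'n)) set" where
  "active_columns S = range Inl \<union> range (Inr \<circ> Inl) \<union> (Inr \<circ> Inr) ` S"

lemma in_active_columns_iff: "c \<in> active_columns S \<longleftrightarrow> (\<forall>i. c = Inr (Inr i) \<longrightarrow> i \<in> S)"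
proof (cases c)
  case (Inr d)
  then show ?thesis by (cases d) (auto simp: active_columns_def)
qed (auto simp: active_columns_def)

lemma active_columns_insert:
  "active_columns (insert i S) = insert (Inr (Inr i)) (active_columns S)"
  by (auto simp: active_columns_def)

text \<open>
  The matrices for different \<open>S\<close> differ only in the columns of the third block, and such a column is
  zero unless it belongs to \<open>S\<close>. So all these matroids are restrictions of the one for \<open>S = UNIV\<close>.
\<close>

lemma linear_matroid_input_restriction:
  "linear_matroid (hcat (mat 1) (hcat (generic_A E) (generic_B S))) =
   {Y \<in> linear_matroid (hcat (mat 1) (hcat (generic_A E) (generic_B UNIV))).
      Y \<subseteq> active_columns S}"
    (is "linear_matroid (?G S) = _")
proof (intro set_eqI)
  fix Y
  have eq: "column c (?G S) = column c (?G UNIV)" if "c \<in> active_columns S" for c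
    using that
    by (auto simp: in_active_columns_iff column_def hcat_def generic_B_def vec_eq_iff
        split: sum.split)
  have "Y \<subseteq> active_columns S" if Y: "Y \<in> linear_matroid (?G S)"
  proof
    fix c assume "c \<in> Y"
    then have "column c (?G S) \<noteq> 0"
      using zero_column_notin_linear_matroid[OF Y] by blast
    then show "c \<in> active_columns S"
      by (auto simp: in_active_columns_iff column_def hcat_def generic_B_def vec_eq_iff
          split: if_splits)
  qed
  moreover have "Y \<in> linear_matroid (?G S) \<longleftrightarrow> Y \<in> linear_matroid (?G UNIV)"
    if "Y \<subseteq> active_columns S"
    using eq that by (intro linear_matroid_cong) blast
  ultimately show "Y \<in> linear_matroid (?G S) \<longleftrightarrow>
      Y \<in> {Y \<in> linear_matroid (?G UNIV). Y \<subseteq> active_columns S}"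
    by blast
qed

text \<open>
  As \<open>[I|Q_A|0]\<close> vanishes in the third block, restricting the second matroid to the active columns
  restricts the whole union. Hence \<open>\<rho>\<^sub>1(S)\<close> is, up to a constant, the rank of the active columns
  of \<open>S\<close> in a matroid that does not depend on \<open>S\<close>.
\<close>

lemma union_input_restriction:
  "matroid_union (linear_matroid (hcat (mat 1) (hcat Q_A 0)))
     (linear_matroid (hcat (mat 1) (hcat (generic_A E) (generic_B S)))) =
   {Z \<in> matroid_union (linear_matroid (hcat (mat 1) (hcat Q_A 0)))
          (linear_matroid (hcat (mat 1) (hcat (generic_A E) (generic_B UNIV)))).
      Z \<subseteq> active_columns S}"
proof -
  have "X \<subseteq> active_columns S" if X: "X \<in> linear_matroid (hcat (mat 1) (hcat Q_A 0))" for X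
  proof
    fix c assume "c \<in> X"
    then have "column c (hcat (mat 1) (hcat Q_A 0)) \<noteq> 0"
      using zero_column_notin_linear_matroid[OF X] by blast
    then show "c \<in> active_columns S"
      by (auto simp: in_active_columns_iff column_def hcat_def vec_eq_iff)
  qed
  then show ?thesis
    unfolding linear_matroid_input_restriction[of E S] matroid_union_def by blast
qed

lemma basis_card_eq_rank_matroid1:
  fixes Q_A :: "real^'n::finite^'n"
  assumes "B \<in> matroid_bases (matroid1 Q_A E)"
  shows "card B = matroid_rank (matroid1 Q_A E)"
proof -
  define N where "N = matroid_union (linear_matroid (hcat (mat 1) (hcat Q_A 0)))
    (linear_matroid (hcat (mat 1) (hcat (generic_A E) (generic_B UNIV))))"
  define c where "c = int (matroid_rank (matroid_union
    (linear_matroid (hcat (mat 1) Q_A)) (linear_matroid (hcat (mat 1) (generic_A E)))))"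
  have union_eq: "matroid_union (linear_matroid (hcat (mat 1) (hcat Q_A 0)))
      (linear_matroid (hcat (mat 1) (hcat (generic_A E) (generic_B S)))) =
    {Z \<in> N. Z \<subseteq> active_columns S}" for S
    unfolding N_def by (rule union_input_restriction)
  have rho: "rho1 Q_A E S = int (matroid_rank {Z \<in> N. Z \<subseteq> active_columns S}) - c" for S
    by (simp only: rho1_def c_def union_eq)
  have ne: "{} \<in> N"
    unfolding N_def by (intro empty_in_matroid_union empty_in_linear_matroid)
  have dc: "downward_closed N"
    unfolding N_def by (intro downward_closed_union downward_closed_linear_matroid)
  have ex: "exchange_property N"
    unfolding N_def
    by (intro exchange_property_union exchange_property_linear_matroid
        downward_closed_linear_matroid)
  show ?thesis
    using assms unfolding matroid1_def
  proof (rule basis_card_eq_rank_of_rank_function[rotated -1])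
    fix S T :: "'n set" assume "S \<subseteq> T"
    then have "active_columns S \<subseteq> active_columns T" by (auto simp: active_columns_def)
    then show "rho1 Q_A E S \<le> rho1 Q_A E T"
      using rank_restriction_monotone[OF ne] by (simp add: rho)
  next
    fix S :: "'n set" and x
    show "rho1 Q_A E (insert x S) \<le> rho1 Q_A E S + 1"
      using rank_restriction_insert[OF ne dc, of "Inr (Inr x)" "active_columns S"]
      by (simp add: rho active_columns_insert)
  next
    fix S :: "'n set" assume closed: "\<And>x. rho1 Q_A E (insert x S) = rho1 Q_A E S"
    have "matroid_rank {Z \<in> N. Z \<subseteq> active_columns UNIV} =
        matroid_rank {Z \<in> N. Z \<subseteq> active_columns S}"
    proof (rule rank_restriction_eqI[OF ne ex])
      show "active_columns S \<subseteq> active_columns UNIV" by (auto simp: active_columns_def)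
    next
      fix e :: "'n + ('n + 'n)"
      show "matroid_rank {Z \<in> N. Z \<subseteq> insert e (active_columns S)} =
          matroid_rank {Z \<in> N. Z \<subseteq> active_columns S}"
      proof (cases "e \<in> active_columns S")
        case False
        then obtain i where "e = Inr (Inr i)" by (auto simp: in_active_columns_iff)
        then show ?thesis using closed[of i] by (simp add: rho active_columns_insert)
      qed (simp add: insert_absorb)
    qed
    then show "rho1 Q_A E UNIV = rho1 Q_A E S" by (simp add: rho)
  qed
qed


section \<open>The matroid $M_2$\<close>

lemma sink_component_unique:
  assumes "C \<in> sink_components G" "D \<in> sink_components G" "v \<in> C" "v \<in> D"
  shows "C = D"
proof -
  have "X \<subseteq> Y" if "X \<in> sink_components G" "Y \<in> sink_components G" "v \<in> X" "v \<in> Y" for X Y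
  proof
    fix u assume "u \<in> X"
    then have "v \<rightarrow>\<^sup>*\<^bsub>with_proj G\<^esub> u" "u \<rightarrow>\<^sup>*\<^bsub>with_proj G\<^esub> v"
      using that by (simp_all add: sink_components_def pre_digraph.sccs_verts_def)
    moreover have "\<forall>w. w \<notin> Y \<longrightarrow> \<not> v \<rightarrow>\<^sup>*\<^bsub>with_proj G\<^esub> w \<or> \<not> w \<rightarrow>\<^sup>*\<^bsub>with_proj G\<^esub> v"
      using that by (simp add: sink_components_def pre_digraph.sccs_verts_def)
    ultimately show "u \<in> Y" by blast
  qed
  from this[OF assms] this[OF assms(2,1,4,3)] show ?thesis by (rule equalityI)
qed

lemma basis_card_eq_rank_matroid2:
  fixes Q_F Q_A :: "real^'n::finite^'n"
  assumes "B \<in> matroid_bases (matroid2 Q_F E_F Q_A E_A m)"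
  shows "card B = matroid_rank (matroid2 Q_F E_F Q_A E_A m)"
proof -
  define K where "K = sink_components (auxiliary_graph Q_F E_F Q_A E_A m)"
  \<comment> \<open>The sink components are disjoint, so \<open>rho2\<close> counts the blocks of a partial partition met by \<open>S\<close>.\<close>
  define hit where "hit S = {C \<in> K. C \<inter> wT ` S \<noteq> {}}" for S
  have rho: "rho2 Q_F E_F Q_A E_A m S = int (card (hit S))" for S
    by (simp add: rho2_def hit_def K_def)
  have single: "\<exists>C. {C \<in> K. wT x \<in> C} \<subseteq> {C}" for x
  proof (cases "\<exists>C\<in>K. wT x \<in> C")
    case True
    then obtain C where "C \<in> K" "wT x \<in> C" by blast
    then have "D = C" if "D \<in> K" "wT x \<in> D" for D
      using that sink_component_unique unfolding K_def by metis
    then show ?thesis by blast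
  qed blast
  have hit_insert: "hit (insert x S) = {C \<in> K. wT x \<in> C} \<union> hit S" for x S
    by (auto simp: hit_def)
  have fin: "finite (hit S)" for S :: "'n set"
  proof (induction S rule: finite_induct[OF finite])
    case 1
    show ?case by (simp add: hit_def)
  next
    case (2 x S)
    have "finite {C \<in> K. wT x \<in> C}"
      using single[of x] by (auto intro: finite_subset)
    with 2 show ?case by (simp add: hit_insert)
  qed
  have mono: "hit S \<subseteq> hit T" if "S \<subseteq> T" for S T
    using that by (auto simp: hit_def)
  show ?thesis
    using assms unfolding matroid2_def
  proof (rule basis_card_eq_rank_of_rank_function[rotated -1])
    fix S T :: "'n set" assume "S \<subseteq> T"
    then show "rho2 Q_F E_F Q_A E_A m S \<le> rho2 Q_F E_F Q_A E_A m T"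
      by (simp add: rho card_mono fin mono)
  next
    fix S :: "'n set" and x
    obtain C where "{C \<in> K. wT x \<in> C} \<subseteq> {C}" using single by blast
    then have "hit (insert x S) \<subseteq> insert C (hit S)" by (auto simp: hit_insert)
    then have "card (hit (insert x S)) \<le> card (insert C (hit S))"
      by (intro card_mono) (simp_all add: fin)
    also have "\<dots> \<le> card (hit S) + 1" by (simp add: card_insert_if fin)
    finally show "rho2 Q_F E_F Q_A E_A m (insert x S) \<le> rho2 Q_F E_F Q_A E_A m S + 1"
      by (simp add: rho)
  next
    fix S :: "'n set"
    assume closed: "\<And>x. rho2 Q_F E_F Q_A E_A m (insert x S) = rho2 Q_F E_F Q_A E_A m S"
    have "hit (insert x S) = hit S" for x
      using closed[of x] mono[of S "insert x S"] card_subset_eq[OF fin, of "hit S" "insert x S"]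
      by (auto simp: rho)
    then have "hit UNIV = hit S"
      unfolding hit_insert by (auto simp: hit_def)
    then show "rho2 Q_F E_F Q_A E_A m UNIV = rho2 Q_F E_F Q_A E_A m S" by (simp add: rho)
  qed
qed


section \<open>Bases of the augmented matroid\<close>

lemma card_augment_le:
  fixes M :: "'a::finite set set"
  assumes "Z \<in> augment k M"
  shows "card Z \<le> k"
proof -
  obtain X Y where Z: "Z = X \<union> Y" and "X \<in> M"
    and Y: "int (card Y) \<le> int k - int (matroid_rank M)"
    using assms by (auto simp: augment_def matroid_union_def uniform_matroid_def)
  then have "card X \<le> matroid_rank M" by (intro matroid_card_le_rank)
  with Y card_Un_le[of X Y] show ?thesis unfolding Z by linarith
qed

text \<open>
  The index \<open>k - r\<close> of the uniform summand may be negative; then there are no independent sets in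
  the augmented matroid, and the next lemma is vacuous.
\<close>

lemma augment_basis_contains_basis:
  fixes M :: "'a::finite set set"
  assumes S: "S \<in> matroid_bases (augment k M)"
  shows "\<exists>B\<in>matroid_bases M. B \<subseteq> S"
proof -
  obtain X Y where XY: "S = X \<union> Y" "X \<in> M"
    "Y \<in> uniform_matroid (int k - int (matroid_rank M))"
    using S by (auto simp: matroid_bases_def augment_def matroid_union_def)
  obtain B where B: "B \<in> matroid_bases M" "X \<subseteq> B"
    using basis_extension[OF \<open>X \<in> M\<close>] .
  have "B \<union> Y \<in> augment k M"
    using B XY unfolding augment_def matroid_union_def matroid_bases_def by blast
  moreover have "S \<subseteq> B \<union> Y" using B XY by blast
  ultimately have "B \<union> Y = S" using S by (simp add: matroid_bases_def)
  with B show ?thesis by blast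
qed

text \<open>
  The minimum with the size of the ground set covers \<open>k > |V|\<close>, where the whole ground set is the
  only basis.
\<close>

lemma augment_basisI:
  fixes M :: "'a::finite set set"
  assumes B: "B \<in> matroid_bases M" "card B = matroid_rank M" "B \<subseteq> S"
    and S: "card S = min k CARD('a)"
  shows "S \<in> matroid_bases (augment k M)"
proof -
  have "int (card (S - B)) = int (card S) - int (card B)"
    using B(3) by (simp add: card_Diff_subset card_mono of_nat_diff)
  then have "S - B \<in> uniform_matroid (int k - int (matroid_rank M))"
    using S B(2) by (simp add: uniform_matroid_def)
  moreover have "B \<in> M" "S = B \<union> (S - B)" using B by (auto simp: matroid_bases_def)
  ultimately have "S \<in> augment k M"
    unfolding augment_def matroid_union_def by blast
  moreover have "Z = S" if "Z \<in> augment k M" "S \<subseteq> Z" for Z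
  proof -
    have "card Z \<le> card S"
      using card_augment_le[OF that(1)] card_mono[of UNIV Z] S by simp
    with that(2) show "Z = S" using card_seteq[of Z S] by simp
  qed
  ultimately show ?thesis by (simp add: matroid_bases_def)
qed

lemma Compl_in_dual_iff: "UNIV - S \<in> matroid_dual M \<longleftrightarrow> (\<exists>B\<in>matroid_bases M. B \<subseteq> S)"
  unfolding matroid_dual_def by blast


theorem lemma3p11:
  fixes Q_F Q_A :: "real^'n::finite^'n"
    and E_F E_A :: "('n \<times> 'n) set"
    and m :: "'n \<Rightarrow> 'n + 'n"
    and f :: "'n set \<Rightarrow> real"
    and k :: nat
    and S_opt :: "'n set"
  assumes "structurally_solvable Q_F E_F Q_A E_A"
    and "independent_matching Q_F E_F Q_A E_A m"
    and "\<forall>S. f S \<ge> 0" and "mono f"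
    and "k > 0"
    and "is_arg_max f
           (\<lambda>S. S \<in> matroid_bases (augment k (matroid1 Q_A E_A)) \<inter>
                    matroid_bases (augment k (matroid2 Q_F E_F Q_A E_A m))) S_opt"
  shows "is_arg_max f
           (\<lambda>S. card S \<le> k \<and>
                UNIV - S \<in> matroid_dual (matroid1 Q_A E_A) \<and>
                UNIV - S \<in> matroid_dual (matroid2 Q_F E_F Q_A E_A m)) S_opt"
proof -
  let ?M1 = "matroid1 Q_A E_A" and ?M2 = "matroid2 Q_F E_F Q_A E_A m"
  let ?good = "\<lambda>S. card S \<le> k \<and>
    (\<exists>B\<in>matroid_bases ?M1. B \<subseteq> S) \<and> (\<exists>B\<in>matroid_bases ?M2. B \<subseteq> S)"
  have opt1: "S_opt \<in> matroid_bases (augment k ?M1)"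
    and opt2: "S_opt \<in> matroid_bases (augment k ?M2)"
    and max: "\<And>T. T \<in> matroid_bases (augment k ?M1) \<Longrightarrow> T \<in> matroid_bases (augment k ?M2) \<Longrightarrow>
      f T \<le> f S_opt"
    using assms(6) by (auto simp: is_arg_max_linorder)
  have "?good S_opt"
    using opt1 opt2 augment_basis_contains_basis card_augment_le[of S_opt k ?M1]
    by (auto simp: matroid_bases_def)
  moreover have "f S \<le> f S_opt" if S: "?good S" for S
  proof -
    have "card S \<le> min k CARD('n)"
      using S card_mono[of UNIV S] by simp
    \<comment> \<open>Fill \<open>S\<close> up to the size of the bases of the augmented matroids.\<close>
    then obtain T where T: "S \<subseteq> T" "card T = min k CARD('n)"
      using exists_subset_between[of S "min k CARD('n)" UNIV] by auto
    have "T \<in> matroid_bases (augment k ?M1)"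
      using S T augment_basisI basis_card_eq_rank_matroid1 by (metis subset_trans)
    moreover have "T \<in> matroid_bases (augment k ?M2)"
      using S T augment_basisI basis_card_eq_rank_matroid2 by (metis subset_trans)
    ultimately have "f T \<le> f S_opt" by (rule max)
    moreover have "f S \<le> f T" using \<open>mono f\<close> T by (auto dest: monoD)
    ultimately show ?thesis by simp
  qed
  ultimately show ?thesis
    unfolding Compl_in_dual_iff is_arg_max_linorder by blast
qed

end
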